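(* Define the sequence $(x_k)_{k\ge1}$ by $x_1=13$ and $x_{k+1}=x_k^2-1$, let $$\beta=\tfrac12\log x_1+\sum_{j=1}^\infty 2^{-j-1}\log\bigl(1-x_j^{-2}\bigr),$$ and let $\alpha=e^{2\beta/5}$ (numerically $\alpha\approx1.66928\,37234\,96921$). Then for all $n\ge1$, $$m_n\ge\lceil\alpha^{n+1}\rceil-2,$$ with equality for infinitely many $n$, and for all $n\ge8$, $$m_n\le\lfloor1.05\cdot\alpha^{n+1}\rfloor-4.$$
   Context: A rooted tree $T$ is a finite tree with a distinguished vertex, its root; its order is its number of vertices. For vertices $u,v$, the infimum of $u$ and $v$ is the vertex common to the path from $u$ to the root and the path from $v$ to the root that is furthest from the root. A set $X\subseteq V(T)$ is infima closed if the infimum of any two elements of $X$ lies in $X$. $I(T)$ denotes the number of nonempty infima closed subsets of $V(T)$. For $n\ge1$, $m_n=\min\{I(T): T \text{ a rooted tree with } n \text{ vertices}\}$. *)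

theory Defs
  imports Complex_Main
begin

text \<open>A rooted tree with vertex set V (vertices are natural numbers; every finite
rooted tree is isomorphic to one of these), root r and parent map par:
par r = r, par maps V into V, and iterating par from any vertex reaches r.\<close>
definition rooted_tree :: "nat set \<Rightarrow> (nat \<Rightarrow> nat) \<Rightarrow> nat \<Rightarrow> bool" where
  "rooted_tree V par r \<longleftrightarrow> finite V \<and> r \<in> V \<and> par r = r \<and>
     (\<forall>v\<in>V. par v \<in> V) \<and> (\<forall>v\<in>V. \<exists>k. (par ^^ k) v = r)"

definition root_path :: "(nat \<Rightarrow> nat) \<Rightarrow> nat \<Rightarrow> nat set" where
  "root_path par v = {(par ^^ k) v | k. True}"

definition depth :: "(nat \<Rightarrow> nat) \<Rightarrow> nat \<Rightarrow> nat \<Rightarrow> nat" where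
  "depth par r v = (LEAST k. (par ^^ k) v = r)"

definition tinf :: "(nat \<Rightarrow> nat) \<Rightarrow> nat \<Rightarrow> nat \<Rightarrow> nat \<Rightarrow> nat" where
  "tinf par r u v = (THE w. w \<in> root_path par u \<inter> root_path par v \<and>
      (\<forall>w'\<in>root_path par u \<inter> root_path par v. depth par r w' \<le> depth par r w))"

definition infima_closed :: "(nat \<Rightarrow> nat) \<Rightarrow> nat \<Rightarrow> nat set \<Rightarrow> bool" where
  "infima_closed par r X \<longleftrightarrow> (\<forall>u\<in>X. \<forall>v\<in>X. tinf par r u v \<in> X)"

definition I_num :: "nat set \<Rightarrow> (nat \<Rightarrow> nat) \<Rightarrow> nat \<Rightarrow> nat" where
  "I_num V par r = card {X. X \<subseteq> V \<and> X \<noteq> {} \<and> infima_closed par r X}"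

definition m_min :: "nat \<Rightarrow> nat" where
  "m_min n = Min {I_num V par r | V par r. rooted_tree V par r \<and> card V = n}"

text \<open>x_1 = 13, x_{k+1} = x_k^2 - 1 (x 0 is an unused dummy value).\<close>
fun xseq :: "nat \<Rightarrow> real" where
  "xseq 0 = 0"
| "xseq (Suc 0) = 13"
| "xseq (Suc (Suc k)) = (xseq (Suc k))^2 - 1"

definition beta_const :: real where
  "beta_const = ln (xseq 1) / 2 +
     (\<Sum>j. ln (1 - 1 / (xseq (Suc j))^2) / 2 ^ (Suc j + 1))"

definition alpha_const :: real where
  "alpha_const = exp (2 * beta_const / 5)"

end

theory Submission
  imports Defs "HOL-Library.FuncSet" "HOL-Library.Nat_Bijection"
begin

text \<open>
  If the branches at the root of \<open>T\<close> are \<open>T\<^sub>c\<close>, then \<open>I(T) = \<Prod>(1 + I(T\<^sub>c)) + \<Sum>I(T\<^sub>c)\<close>. In terms of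
  \<open>N = n + 1\<close> and \<open>y = I + 2\<close>, joining two trees under a new root adds the \<open>N\<close> and maps
  \<open>y, w\<close> to \<open>yw - 1\<close>; starting from the star with \<open>N = 5\<close>, \<open>y = 13\<close>, repeated doubling gives
  \<open>x\<^sub>k\<close> at \<open>N = 5 \<cdot> 2^(k-1)\<close>, where \<open>\<alpha>^N\<close> lies between \<open>x\<^sub>k - 2/x\<^sub>k\<close> and \<open>x\<^sub>k\<close>.
  For the lower bound, \<open>y \<ge> \<alpha>^N\<close> is not inductive, since joining loses 1. It is strengthened to
  \<open>y \<ge> F\<^sub>k(\<alpha>^N)\<close> for all \<open>k\<close>, where \<open>F\<^sub>k(t)\<close> applies the \<open>k\<close>-th inverse iterate of
  \<open>x \<mapsto> x^2 - 1\<close> to \<open>t^(2^k)\<close>; then \<open>F\<^sub>k\<^sub>+\<^sub>1(s) F\<^sub>k\<^sub>+\<^sub>1(t) \<ge> F\<^sub>k(st) + 1\<close> absorbs the loss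
  exactly, and vertices with one or with at least three children leave room to spare.
  For the upper bound, a small tree in each residue class of \<open>N\<close> modulo 5 is joined with the doubling
  trees given by the binary digits of the quotient.
\<close>

section \<open>Infima closed sets of a rooted tree\<close>

locale rtree =
  fixes V :: "nat set" and par :: "nat \<Rightarrow> nat" and r :: nat
  assumes tree: "rooted_tree V par r"
begin

abbreviation "rp \<equiv> root_path par"
abbreviation "dep \<equiv> depth par r"
abbreviation "inf2 \<equiv> tinf par r"

lemma finite_V: "finite V" and root_in: "r \<in> V" and par_root [simp]: "par r = r"
  and par_in: "v \<in> V \<Longrightarrow> par v \<in> V" and reach_root: "v \<in> V \<Longrightarrow> \<exists>k. (par ^^ k) v = r"
  using tree by (auto simp: rooted_tree_def)

section \<open>Paths to the root and infima\<close>

lemma rp_self: "v \<in> rp v"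
  unfolding root_path_def by (auto intro: exI[of _ 0])

lemma rp_unfold: "rp v = insert v (rp (par v))"
proof -
  have "(par ^^ k) v \<in> insert v (rp (par v))" for k
    by (cases k) (auto simp: root_path_def funpow_swap1)
  moreover have "(par ^^ k) (par v) \<in> rp v" for k
    unfolding root_path_def by (auto simp: funpow_swap1 intro: exI[of _ "Suc k"])
  ultimately show ?thesis
    using rp_self[of v] by (auto simp: root_path_def)
qed

lemma rp_par: "par v \<in> rp v"
  using rp_unfold rp_self by blast

lemma rp_trans: "w \<in> rp v \<Longrightarrow> u \<in> rp w \<Longrightarrow> u \<in> rp v"
  unfolding root_path_def by (auto simp: funpow_add[symmetric, THEN fun_cong, simplified])

lemma rp_linear: "w \<in> rp v \<Longrightarrow> w' \<in> rp v \<Longrightarrow> w \<in> rp w' \<or> w' \<in> rp w"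
proof -
  assume "w \<in> rp v" "w' \<in> rp v"
  then obtain a b where ab: "w = (par ^^ a) v" "w' = (par ^^ b) v"
    by (auto simp: root_path_def)
  have *: "(par ^^ j) v \<in> rp ((par ^^ i) v)" if "i \<le> j" for i j
  proof -
    have "(par ^^ j) v = (par ^^ (j - i)) ((par ^^ i) v)"
      using that by (metis comp_apply funpow_add le_add_diff_inverse2)
    then show ?thesis
      by (auto simp: root_path_def)
  qed
  show ?thesis
    using *[of a b] *[of b a] ab by (cases "a \<le> b") auto
qed

lemma rp_root: "rp r = {r}"
proof -
  have "(par ^^ k) r = r" for k
    by (induction k) auto
  then show ?thesis
    by (auto simp: root_path_def)
qed

lemma rp_subset: "v \<in> V \<Longrightarrow> rp v \<subseteq> V"
proof -
  assume "v \<in> V"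
  then have "(par ^^ k) v \<in> V" for k
    by (induction k) (auto intro: par_in)
  then show ?thesis
    by (auto simp: root_path_def)
qed

lemma root_in_rp: "v \<in> V \<Longrightarrow> r \<in> rp v"
  using reach_root unfolding root_path_def by fastforce

lemma depth_par: 
  assumes "v \<in> V" "v \<noteq> r"
  shows "dep (par v) < dep v"
proof -
  have "(par ^^ dep v) v = r"
    unfolding depth_def using reach_root[OF assms(1)] by (rule LeastI_ex)
  then obtain d where d: "dep v = Suc d" "(par ^^ d) (par v) = r"
    using assms(2) by (cases "dep v") (auto simp: funpow_swap1)
  then have "dep (par v) \<le> d"
    unfolding depth_def by (auto intro: Least_le)
  then show ?thesis
    using d by simp
qed

text \<open>Each step to the parent lowers the depth, so this is induction on the depth, phrased to
  run from the root downwards.\<close>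

lemma tree_induct [consumes 1, case_names root step]:
  assumes "v \<in> V" and "P r" and "\<And>v. v \<in> V \<Longrightarrow> v \<noteq> r \<Longrightarrow> P (par v) \<Longrightarrow> P v"
  shows "P v"
  using assms(1)
proof (induction "dep v" arbitrary: v rule: less_induct)
  case less
  then show ?case
    using assms(2,3) depth_par par_in by metis
qed

lemma depth_rp:
  assumes "v \<in> V" "w \<in> rp v"
  shows "w = v \<or> dep w < dep v"
  using assms
proof (induction arbitrary: w rule: tree_induct)
  case root
  then show ?case using rp_root by auto
next
  case (step v)
  then show ?case using rp_unfold[of v] depth_par[of v] by fastforce
qed

lemma rp_antisym: "v \<in> V \<Longrightarrow> w \<in> rp v \<Longrightarrow> v \<in> rp w \<Longrightarrow> w = v"
  using depth_rp[of v w] depth_rp[of w v] rp_subset by fastforce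

lemma rp_inject: "v \<in> V \<Longrightarrow> rp v = rp w \<Longrightarrow> w = v"
  using rp_antisym rp_self by metis

text \<open>Root paths are chains, so every common vertex lies on the path of the deepest one,
  \<open>w\<close>. Later arguments can then use intersections of paths instead of
  \<open>THE\<close> and depths.\<close>

lemma rp_tinf:
  assumes u: "u \<in> V" and v: "v \<in> V"
  shows "rp u \<inter> rp v = rp (inf2 u v)"
proof -
  let ?D = "rp u \<inter> rp v"
  have "finite ?D" "r \<in> ?D"
    using rp_subset[OF u] finite_V root_in_rp u v by (auto intro: finite_subset)
  then have fin: "finite (dep ` ?D)" "dep ` ?D \<noteq> {}"
    by blast+
  then have "Max (dep ` ?D) \<in> dep ` ?D"
    by (rule Max_in)
  then obtain w where w: "w \<in> ?D" and "dep w = Max (dep ` ?D)"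
    by (metis (no_types, lifting) imageE)
  then have wmax: "\<forall>w'\<in>?D. dep w' \<le> dep w"
    using fin Max_ge by (metis (no_types, lifting) imageI)
  have wV: "w \<in> V"
    using w rp_subset[OF u] by auto
  have eq: "?D = rp w"
  proof
    show "rp w \<subseteq> ?D"
      using w rp_trans by blast
    show "?D \<subseteq> rp w"
    proof
      fix w' assume w': "w' \<in> ?D"
      then have "w' \<in> V" "dep w' \<le> dep w"
        using rp_subset[OF u] wmax by auto
      moreover have "w \<in> rp w' \<or> w' \<in> rp w"
        using rp_linear w w' by blast
      ultimately show "w' \<in> rp w"
        using depth_rp[of w' w] rp_self by auto
    qed
  qed
  have "inf2 u v = w"
    unfolding tinf_def
  proof (rule the_equality)
    show "w \<in> ?D \<and> (\<forall>w'\<in>?D. dep w' \<le> dep w)"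
      using w wmax by simp
    fix w' assume w': "w' \<in> ?D \<and> (\<forall>w''\<in>?D. dep w'' \<le> dep w')"
    then have "dep w \<le> dep w'" "w' \<in> rp w"
      using eq w by blast+
    then show "w' = w"
      using depth_rp[OF wV, of w'] by simp
  qed
  then show ?thesis
    using eq by simp
qed

lemma tinf_in: "u \<in> V \<Longrightarrow> v \<in> V \<Longrightarrow> inf2 u v \<in> V"
  using rp_tinf rp_self rp_subset by blast

lemma tinf_eqI: "u \<in> V \<Longrightarrow> v \<in> V \<Longrightarrow> rp u \<inter> rp v = rp w \<Longrightarrow> inf2 u v = w"
  using rp_tinf tinf_in rp_inject by metis

text \<open>This form, free of \<open>tinf\<close> and depth, can be carried through the coding of
  joined trees, where root paths are known explicitly.\<close>

lemma infima_closed_iff: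
  assumes "X \<subseteq> V"
  shows "infima_closed par r X \<longleftrightarrow> (\<forall>u\<in>X. \<forall>v\<in>X. \<exists>w\<in>X. rp u \<inter> rp v = rp w)"
  unfolding infima_closed_def using assms tinf_eqI rp_tinf by (metis subsetD)

section \<open>Branches at a vertex and the recursion for closed sets\<close>

definition desc :: "nat \<Rightarrow> nat set" where
  "desc v = {u \<in> V. v \<in> rp u}"

definition children :: "nat \<Rightarrow> nat set" where
  "children v = {c \<in> V. par c = v \<and> c \<noteq> r}"

definition closed_sets :: "nat \<Rightarrow> nat set set" where
  "closed_sets v = {X. X \<subseteq> desc v \<and> infima_closed par r X}"

lemma desc_root: "desc r = V"
  using root_in_rp by (auto simp: desc_def)

lemma finite_desc: "finite (desc v)" and finite_children: "finite (children v)"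
  using finite_V by (auto simp: desc_def children_def)

lemma finite_closed_sets: "finite (closed_sets v)"
  unfolding closed_sets_def using finite_desc by auto

lemma empty_closed: "{} \<in> closed_sets v"
  by (auto simp: closed_sets_def infima_closed_def)

lemma children_subset: "children v \<subseteq> V"
  by (auto simp: children_def)

lemma child_not_above:
  assumes "c \<in> children v"
  shows "c \<notin> rp v"
proof
  assume "c \<in> rp v"
  moreover have c: "c \<in> V" "c \<noteq> r" "v = par c"
    using assms by (auto simp: children_def)
  ultimately have "v = c"
    using rp_antisym[OF c(1)] rp_par by metis
  then show False
    using depth_par[OF c(1,2)] c(3) by simp
qed

text \<open>Two children of \<open>v\<close> on one path are comparable; if they differed, the upper
  one would lie on the path of \<open>v\<close>, against \<open>child_not_above\<close>.\<close>

lemma desc_children_disjoint: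
  assumes "c \<in> children v" "c' \<in> children v" "c \<in> rp u" "c' \<in> rp u"
  shows "c = c'"
proof -
  have *: "c = c'" if "c \<in> rp c'" "c \<in> children v" "c' \<in> children v" for c c'
    using that child_not_above[of c v] rp_unfold[of c'] by (auto simp: children_def)
  show ?thesis
    using rp_linear[OF assms(3,4)] *[of c c'] *[of c' c] assms by auto
qed

lemma desc_unfold: 
  assumes "v \<in> V"
  shows "desc v = insert v (\<Union>c\<in>children v. desc c)"
proof
  have "u = v \<or> (\<exists>c\<in>children v. u \<in> desc c)" if "u \<in> V" "v \<in> rp u" for u
    using that
  proof (induction rule: tree_induct)
    case root
    then show ?case using rp_root by simp
  next
    case (step u)
    consider "v = u" | "u \<noteq> v" "v \<in> rp (par u)"
      using step.prems rp_unfold[of u] by auto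
    then show ?case
    proof cases
      case 2
      then show ?thesis
        using step rp_self[of u] rp_trans[OF rp_par[of u]] by (auto simp: children_def desc_def)
    qed simp
  qed
  then show "desc v \<subseteq> insert v (\<Union>c\<in>children v. desc c)"
    by (auto simp: desc_def)
  show "insert v (\<Union>c\<in>children v. desc c) \<subseteq> desc v"
    using assms rp_self rp_par rp_trans by (fastforce simp: desc_def children_def)
qed

lemma self_notin_desc_child: "c \<in> children v \<Longrightarrow> v \<notin> desc c"
  using child_not_above by (auto simp: desc_def)

lemma card_desc:
  assumes "v \<in> V"
  shows "card (desc v) = 1 + (\<Sum>c\<in>children v. card (desc c))"
proof -
  have "card (\<Union>c\<in>children v. desc c) = (\<Sum>c\<in>children v. card (desc c))"
    using desc_children_disjoint
    by (intro card_UN_disjoint) (auto simp: finite_children finite_desc, auto simp: desc_def)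
  then show ?thesis
    using self_notin_desc_child by (subst desc_unfold[OF assms], subst card_insert_disjoint)
      (auto simp: finite_children finite_desc)
qed

lemma tinf_in_desc: "u \<in> desc c \<Longrightarrow> u' \<in> desc c \<Longrightarrow> inf2 u u' \<in> desc c"
  using rp_tinf[of u u'] tinf_in[of u u'] by (auto simp: desc_def)

lemma tinf_self_desc:
  assumes "v \<in> V" "u \<in> desc v"
  shows "inf2 u v = v" "inf2 v u = v"
  using assms rp_trans by (auto intro!: tinf_eqI simp: desc_def)

lemma tinf_distinct_branches:
  assumes "v \<in> V" "c \<in> children v" "c' \<in> children v" "c \<noteq> c'" "u \<in> desc c" "u' \<in> desc c'"
  shows "inf2 u u' = v"
proof -
  let ?w = "inf2 u u'"
  have w: "rp u \<inter> rp u' = rp ?w"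
    using assms rp_tinf by (auto simp: desc_def)
  have "?w \<in> desc v"
    using assms desc_unfold[OF assms(1)] by (intro tinf_in_desc) auto
  moreover have False if "c'' \<in> children v" "?w \<in> desc c''" for c''
  proof -
    have "c'' \<in> rp u" "c'' \<in> rp u'"
      using w that by (auto simp: desc_def)
    then show False
      using desc_children_disjoint[OF that(1)] assms by (auto simp: desc_def)
  qed
  ultimately show ?thesis
    using desc_unfold[OF assms(1)] by auto
qed

text \<open>Once \<open>v\<close> belongs to the set, infima between different branches equal
  \<open>v\<close> and impose nothing, so the traces on the branches are independent.\<close>

lemma card_closed_with_root:
  assumes v: "v \<in> V"
  shows "card {X \<in> closed_sets v. v \<in> X} = (\<Prod>c\<in>children v. card (closed_sets c))"
proof -
  let ?C = "children v"
  let ?f = "\<lambda>X. \<lambda>c\<in>?C. X \<inter> desc c"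
  let ?g = "\<lambda>h. insert v (\<Union>c\<in>?C. h c)"
  have sub: "h c \<subseteq> desc c" if "h \<in> (\<Pi>\<^sub>E c\<in>?C. closed_sets c)" "c \<in> ?C" for h c
    using that by (auto simp: PiE_iff closed_sets_def)
  have "bij_betw ?f {X \<in> closed_sets v. v \<in> X} (\<Pi>\<^sub>E c\<in>?C. closed_sets c)"
  proof (rule bij_betwI[where g = ?g])
    show "?f \<in> {X \<in> closed_sets v. v \<in> X} \<rightarrow> (\<Pi>\<^sub>E c\<in>?C. closed_sets c)"
      using tinf_in_desc by (auto simp: closed_sets_def infima_closed_def)
    show "?g \<in> (\<Pi>\<^sub>E c\<in>?C. closed_sets c) \<rightarrow> {X \<in> closed_sets v. v \<in> X}"
    proof (intro funcsetI CollectI conjI)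
      fix h assume h: "h \<in> (\<Pi>\<^sub>E c\<in>?C. closed_sets c)"
      have "?g h \<subseteq> desc v"
        using sub[OF h] desc_unfold[OF v] by blast
      moreover have "inf2 a b \<in> ?g h" if a: "a \<in> ?g h" and b: "b \<in> ?g h" for a b
      proof (cases "a = v \<or> b = v")
        case True
        then show ?thesis
          using tinf_self_desc[OF v] a b \<open>?g h \<subseteq> desc v\<close> by (metis insertI1 subsetD)
      next
        case False
        then obtain c c' where c: "c \<in> ?C" "c' \<in> ?C" "a \<in> h c" "b \<in> h c'"
          using a b by auto
        show ?thesis
        proof (cases "c = c'")
          case True
          then have "inf2 a b \<in> h c"
            using c h by (auto simp: PiE_iff closed_sets_def infima_closed_def)
          then show ?thesis using c by auto
        next
          case False
          then show ?thesis
            using tinf_distinct_branches[OF v c(1,2)] sub[OF h] c by blast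
        qed
      qed
      ultimately show "?g h \<in> closed_sets v"
        by (auto simp: closed_sets_def infima_closed_def)
    qed auto
    show "?g (?f X) = X" if "X \<in> {X \<in> closed_sets v. v \<in> X}" for X
      using that desc_unfold[OF v] by (auto simp: closed_sets_def)
    show "?f (?g h) = h" if h: "h \<in> (\<Pi>\<^sub>E c\<in>?C. closed_sets c)" for h
    proof
      fix c
      show "?f (?g h) c = h c"
      proof (cases "c \<in> ?C")
        case True
        have "h c' \<inter> desc c = {}" if "c' \<in> ?C" "c' \<noteq> c" for c'
          using sub[OF h that(1)] that True desc_children_disjoint[OF that(1) True] 
          by (auto simp: desc_def)
        then show ?thesis
          using True sub[OF h True] self_notin_desc_child[OF True] by auto
      next
        case False
        then show ?thesis using h by (auto simp: PiE_iff extensional_def)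
      qed
    qed
  qed
  then show ?thesis
    by (simp add: bij_betw_same_card card_PiE[OF finite_children])
qed

text \<open>Elements of different branches have infimum \<open>v\<close>, so a closed set avoiding
  \<open>v\<close> stays inside one branch.\<close>

lemma closed_without_root:
  assumes v: "v \<in> V"
  shows "{X \<in> closed_sets v. v \<notin> X} = insert {} (\<Union>c\<in>children v. closed_sets c - {{}})"
proof
  show "{X \<in> closed_sets v. v \<notin> X} \<subseteq> insert {} (\<Union>c\<in>children v. closed_sets c - {{}})"
  proof
    fix X assume X: "X \<in> {X \<in> closed_sets v. v \<notin> X}"
    show "X \<in> insert {} (\<Union>c\<in>children v. closed_sets c - {{}})"
    proof (cases "X = {}")
      case False
      then obtain u where u: "u \<in> X" by auto
      then obtain c where c: "c \<in> children v" "u \<in> desc c"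
        using X desc_unfold[OF v] by (auto simp: closed_sets_def)
      have "u' \<in> desc c" if u': "u' \<in> X" for u'
      proof -
        obtain c' where c': "c' \<in> children v" "u' \<in> desc c'"
          using u' X desc_unfold[OF v] by (auto simp: closed_sets_def)
        have "inf2 u u' \<in> X"
          using u u' X by (auto simp: closed_sets_def infima_closed_def)
        then show ?thesis
          using tinf_distinct_branches[OF v c(1) c'(1) _ c(2) c'(2)] X c' by auto
      qed
      then show ?thesis
        using c X False by (auto simp: closed_sets_def)
    qed auto
  qed
  show "insert {} (\<Union>c\<in>children v. closed_sets c - {{}}) \<subseteq> {X \<in> closed_sets v. v \<notin> X}"
    using empty_closed desc_unfold[OF v] self_notin_desc_child by (auto simp: closed_sets_def)
qed

lemma card_closed_without_root:
  assumes v: "v \<in> V"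
  shows "card {X \<in> closed_sets v. v \<notin> X} = 1 + (\<Sum>c\<in>children v. card (closed_sets c) - 1)"
proof -
  have disj: "(closed_sets c - {{}}) \<inter> (closed_sets c' - {{}}) = {}"
    if "c \<in> children v" "c' \<in> children v" "c \<noteq> c'" for c c'
    using desc_children_disjoint[OF that(1,2)] that(3)
    by (auto simp: closed_sets_def desc_def subset_iff) 
  have "card (\<Union>c\<in>children v. closed_sets c - {{}}) = (\<Sum>c\<in>children v. card (closed_sets c - {{}}))"
    using disj by (intro card_UN_disjoint) (auto simp: finite_children finite_closed_sets)
  also have "\<dots> = (\<Sum>c\<in>children v. card (closed_sets c) - 1)"
    by (intro sum.cong) (auto simp: card_Diff_singleton empty_closed)
  finally show ?thesis
    by (subst closed_without_root[OF v], subst card_insert_disjoint)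
      (auto simp: finite_children finite_closed_sets)
qed

text \<open>\<open>closed_sets\<close> contains the empty set: the sum removes it from each branch,
  and the final \<open>1\<close> counts it once.\<close>

lemma card_closed_sets:
  assumes v: "v \<in> V"
  shows "card (closed_sets v) =
    (\<Prod>c\<in>children v. card (closed_sets c)) + (\<Sum>c\<in>children v. card (closed_sets c) - 1) + 1"
proof -
  have "closed_sets v = {X \<in> closed_sets v. v \<in> X} \<union> {X \<in> closed_sets v. v \<notin> X}"
    by auto
  then have "card (closed_sets v) =
    card {X \<in> closed_sets v. v \<in> X} + card {X \<in> closed_sets v. v \<notin> X}"
    using finite_closed_sets by (metis (no_types, lifting) card_Un_disjoint disjoint_iff
      finite_Un mem_Collect_eq)
  then show ?thesis
    using card_closed_with_root[OF v] card_closed_without_root[OF v] by simp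
qed

lemma card_closed_sets_pos: "card (closed_sets v) \<ge> 1"
  using empty_closed finite_closed_sets by (metis One_nat_def Suc_leI card_gt_0_iff empty_iff)

lemma I_num_eq: "I_num V par r = card (closed_sets r) - 1"
proof -
  have "{X. X \<subseteq> V \<and> X \<noteq> {} \<and> infima_closed par r X} = closed_sets r - {{}}"
    by (auto simp: closed_sets_def desc_root)
  then show ?thesis
    unfolding I_num_def by (simp add: card_Diff_singleton empty_closed)
qed

end

section \<open>Joining trees under a new root\<close>

definition attains :: "nat \<Rightarrow> nat \<Rightarrow> bool" where
  "attains n i \<longleftrightarrow> (\<exists>V par r. rooted_tree V par r \<and> card V = n \<and> I_num V par r = i)"

text \<open>Tagging with \<open>i\<close> keeps the trees apart, and the successor frees 0 for the
  new root.\<close>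

definition join_enc :: "nat \<Rightarrow> nat \<Rightarrow> nat" where
  "join_enc i x = Suc (prod_encode (i, x))"

definition join_par :: "(nat \<Rightarrow> nat \<Rightarrow> nat) \<Rightarrow> (nat \<Rightarrow> nat) \<Rightarrow> nat \<Rightarrow> nat" where
  "join_par P R y = (case y of 0 \<Rightarrow> 0 | Suc m \<Rightarrow>
     (case prod_decode m of (i, x) \<Rightarrow> if x = R i then 0 else join_enc i (P i x)))"

lemma join_enc_inject [simp]: "join_enc i x = join_enc j y \<longleftrightarrow> i = j \<and> x = y"
  by (auto simp: join_enc_def)

lemma join_enc_neq_0 [simp]: "join_enc i x \<noteq> 0" "0 \<noteq> join_enc i x" "0 < join_enc i x"
  by (auto simp: join_enc_def)

lemma join_par_enc [simp]: "join_par P R (join_enc i x) = (if x = R i then 0 else join_enc i (P i x))"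
  by (simp add: join_par_def join_enc_def)

lemma join_par_0 [simp]: "join_par P R 0 = 0"
  by (simp add: join_par_def)

locale join =
  fixes k :: nat and W :: "nat \<Rightarrow> nat set" and P :: "nat \<Rightarrow> nat \<Rightarrow> nat" and R :: "nat \<Rightarrow> nat"
  assumes trees: "i < k \<Longrightarrow> rtree (W i) (P i) (R i)"
begin

abbreviation "JV \<equiv> insert 0 (\<Union>i<k. join_enc i ` W i)"
abbreviation "JP \<equiv> join_par P R"

lemma join_reach:
  assumes "i < k" "x \<in> W i"
  shows "\<exists>n. (JP ^^ n) (join_enc i x) = 0"
proof -
  interpret rtree "W i" "P i" "R i" by (rule trees) fact
  show ?thesis
    using assms(2)
  proof (induction rule: tree_induct)
    case root
    show ?case by (rule exI[of _ 1]) simp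
  next
    case (step v)
    then obtain n where "(JP ^^ n) (join_enc i (P i v)) = 0" by auto
    then show ?case
      using step.hyps by (intro exI[of _ "Suc n"]) (simp add: funpow_swap1)
  qed
qed

lemma rooted_tree_join: "rooted_tree JV JP 0"
proof -
  have "JP v \<in> JV" if "v \<in> JV" for v
  proof (cases "v = 0")
    case False
    then obtain i x where "i < k" "x \<in> W i" "v = join_enc i x"
      using \<open>v \<in> JV\<close> by blast
    then show ?thesis
      using rtree.par_in[OF trees] by fastforce
  qed simp
  moreover have "finite JV"
    using rtree.finite_V[OF trees] by auto
  ultimately show ?thesis
    unfolding rooted_tree_def using join_reach by (auto intro: exI[of _ 0])
qed

sublocale J: rtree JV JP 0
  using rooted_tree_join by unfold_locales

lemma root_path_join:
  assumes "i < k" "x \<in> W i"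
  shows "root_path JP (join_enc i x) = insert 0 (join_enc i ` root_path (P i) x)"
proof -
  interpret rtree "W i" "P i" "R i" by (rule trees) fact
  show ?thesis
    using assms(2)
  proof (induction rule: tree_induct)
    case root
    show ?case by (subst J.rp_unfold) (auto simp: J.rp_root rp_root)
  next
    case (step v)
    then show ?case
      by (subst J.rp_unfold, subst rp_unfold) auto
  qed
qed

lemma children_join: "J.children 0 = (\<lambda>i. join_enc i (R i)) ` {..<k}"
  using rtree.root_in[OF trees] by (auto simp: J.children_def image_iff split: if_splits)

lemma desc_join:
  assumes i: "i < k"
  shows "J.desc (join_enc i (R i)) = join_enc i ` W i"
proof -
  interpret rtree "W i" "P i" "R i" by (rule trees) fact
  show ?thesis
    using i root_in_rp root_path_join by (auto simp: J.desc_def J.rp_root)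
qed

text \<open>Coding adds only the vertex 0 to each root path, and 0 is never a code. Intersections of
  paths therefore correspond, and \<open>infima_closed_iff\<close> transfers closedness.\<close>

lemma closed_sets_join:
  assumes i: "i < k"
  shows "J.closed_sets (join_enc i (R i)) = (`) (join_enc i) ` rtree.closed_sets (W i) (P i) (R i) (R i)"
proof -
  interpret rtree "W i" "P i" "R i" by (rule trees) fact
  have *: "infima_closed JP 0 (join_enc i ` X) \<longleftrightarrow> infima_closed (P i) (R i) X" if X: "X \<subseteq> W i" for X
  proof -
    have "join_enc i ` X \<subseteq> JV"
      using X i by auto
    moreover have "root_path JP (join_enc i u) \<inter> root_path JP (join_enc i v) = root_path JP (join_enc i w)
        \<longleftrightarrow> root_path (P i) u \<inter> root_path (P i) v = root_path (P i) w"
      if "u \<in> X" "v \<in> X" "w \<in> X" for u v w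
    proof -
      have inj: "inj (join_enc i)"
        by (auto simp: inj_def)
      have "insert 0 (join_enc i ` A) \<inter> insert 0 (join_enc i ` B) = insert 0 (join_enc i ` C)
        \<longleftrightarrow> A \<inter> B = C" for A B C
      proof -
        have "insert 0 (join_enc i ` A) \<inter> insert 0 (join_enc i ` B) = insert 0 (join_enc i ` (A \<inter> B))"
          using inj by (auto simp: image_Int)
        moreover have "insert 0 (join_enc i ` D) = insert 0 (join_enc i ` C) \<longleftrightarrow> D = C" for D C
          using inj by (subst insert_ident) (auto simp: inj_image_eq_iff)
        ultimately show ?thesis by simp
      qed
      then show ?thesis
        using that X i by (simp add: root_path_join subset_iff)
    qed
    ultimately show ?thesis
      using J.infima_closed_iff[of "join_enc i ` X"] infima_closed_iff[OF X] by simp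
  qed
  show ?thesis
  proof (intro equalityI subsetI)
    fix Y assume "Y \<in> J.closed_sets (join_enc i (R i))"
    then have Y: "Y \<subseteq> join_enc i ` W i" "infima_closed JP 0 Y"
      by (auto simp: J.closed_sets_def desc_join[OF i])
    then obtain X where X: "X \<subseteq> W i" "Y = join_enc i ` X"
      by (auto simp: subset_image_iff)
    then show "Y \<in> (`) (join_enc i) ` closed_sets (R i)"
      using Y *[OF X(1)] by (auto simp: closed_sets_def desc_root)
  next
    fix Y assume "Y \<in> (`) (join_enc i) ` closed_sets (R i)"
    then show "Y \<in> J.closed_sets (join_enc i (R i))"
      using * by (auto simp: J.closed_sets_def desc_join[OF i] closed_sets_def desc_root)
  qed
qed

lemma card_closed_sets_join:
  assumes i: "i < k"
  shows "card (J.closed_sets (join_enc i (R i))) = 1 + I_num (W i) (P i) (R i)"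
proof -
  interpret rtree "W i" "P i" "R i" by (rule trees) fact
  have "inj (join_enc i)"
    by (auto simp: inj_def)
  then have "inj ((`) (join_enc i))"
    by (auto simp: inj_def inj_image_eq_iff)
  then show ?thesis
    using card_closed_sets_pos[of "R i"] closed_sets_join[OF i] I_num_eq
    by (simp add: card_image inj_on_subset)
qed

lemma I_num_join:
  "I_num JV JP 0 = (\<Prod>i<k. 1 + I_num (W i) (P i) (R i)) + (\<Sum>i<k. I_num (W i) (P i) (R i))"
proof -
  have inj: "inj_on (\<lambda>i. join_enc i (R i)) {..<k}"
    by (auto simp: inj_on_def)
  show ?thesis
    using J.card_closed_sets[of 0] J.root_in
    by (simp add: J.I_num_eq children_join prod.reindex[OF inj] sum.reindex[OF inj]
      card_closed_sets_join)
qed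

lemma card_join: "card JV = 1 + (\<Sum>i<k. card (W i))"
proof -
  have "card (\<Union>i<k. join_enc i ` W i) = (\<Sum>i<k. card (join_enc i ` W i))"
    using rtree.finite_V[OF trees] by (intro card_UN_disjoint) auto
  also have "\<dots> = (\<Sum>i<k. card (W i))"
    by (intro sum.cong card_image) (auto simp: inj_on_def)
  finally show ?thesis
    using rtree.finite_V[OF trees] by (subst card_insert_disjoint) auto
qed

end

section \<open>Values attained by trees and their minimum\<close>

lemma attains_join:
  fixes k :: nat
  assumes "\<And>i. i < k \<Longrightarrow> attains (n i) (a i)"
  shows "attains (1 + (\<Sum>i<k. n i)) ((\<Prod>i<k. 1 + a i) + (\<Sum>i<k. a i))"
proof -
  have "\<forall>i. \<exists>V par r. i < k \<longrightarrow> rooted_tree V par r \<and> card V = n i \<and> I_num V par r = a i"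
    using assms by (simp add: attains_def)
  then obtain W P R where *: "\<And>i. i < k \<Longrightarrow> rooted_tree (W i) (P i) (R i) \<and> card (W i) = n i
      \<and> I_num (W i) (P i) (R i) = a i"
    by metis
  interpret join k W P R
    using * by unfold_locales auto
  show ?thesis
    unfolding attains_def using rooted_tree_join card_join I_num_join * by fastforce
qed

text \<open>The new value plus 2 is \<open>(a + 2) * (b + 2) - 1\<close>, the shape behind
  \<open>xseq\<close>.\<close>

lemma attains_join2:
  assumes "attains n a" "attains m b"
  shows "attains (n + m + 1) ((1 + a) * (1 + b) + a + b)"
  using attains_join[of 2 "\<lambda>i. if i = 0 then n else m" "\<lambda>i. if i = 0 then a else b"] assms
  by (simp add: numeral_2_eq_2 add.assoc)

lemma attains_leaf: "attains 1 1"
  using attains_join[of 0] by simp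

lemma attains_star: "attains (1 + k) (2 ^ k + k)"
  using attains_join[of k "\<lambda>_. 1" "\<lambda>_. 1", OF attains_leaf] by (simp add: numeral_2_eq_2)

text \<open>Makes the set under \<open>Min\<close> in \<open>m_min\<close> nonempty for every
  positive order.\<close>

lemma attains_chain: "\<exists>a. attains (Suc n) a"
proof (induction n)
  case 0
  then show ?case using attains_leaf by auto
next
  case (Suc n)
  then obtain a where "attains (Suc n) a" by auto
  then show ?case
    using attains_join[of 1 "\<lambda>_. Suc n" "\<lambda>_. a"] by auto
qed

lemma attains_m_min:
  assumes "n \<ge> 1"
  shows "attains n (m_min n)" and "attains n a \<Longrightarrow> m_min n \<le> a"
proof -
  let ?S = "{I_num V par r | V par r. rooted_tree V par r \<and> card V = n}"
  have S: "?S = {a. attains n a}"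
    by (auto simp: attains_def)
  \<comment> \<open>\<open>Min\<close> needs a finite set; counting all sets of vertices bounds the
    values.\<close>
  have "a \<le> 2 ^ n" if "attains n a" for a
  proof -
    from that obtain V par r where t: "rooted_tree V par r" "card V = n" "I_num V par r = a"
      by (auto simp: attains_def)
    have "I_num V par r \<le> card (Pow V)"
      unfolding I_num_def using t(1) by (intro card_mono) (auto simp: rooted_tree_def)
    then show ?thesis
      using t by (simp add: card_Pow rooted_tree_def)
  qed
  then have fin: "finite ?S"
    unfolding S by (metis finite_nat_set_iff_bounded_le mem_Collect_eq)
  have "?S \<noteq> {}"
    unfolding S using attains_chain[of "n - 1"] assms by auto
  then have "m_min n \<in> ?S"
    unfolding m_min_def by (rule Min_in[OF fin])
  then show "attains n (m_min n)"
    unfolding S by simp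
  show "m_min n \<le> a" if "attains n a"
    unfolding m_min_def using that S by (intro Min_le fin) blast
qed


section \<open>The growth constant\<close>

abbreviation z :: "nat \<Rightarrow> real" where
  "z k \<equiv> xseq (Suc k)"

lemma z_ge: "z k \<ge> 13"
proof (induction k)
  case (Suc k)
  then have "z k * z k \<ge> 13 * 13"
    by (intro mult_mono) auto
  then show ?case by (simp add: power2_eq_square)
qed simp

text \<open>The partial sums defining \<open>\<beta>\<close> telescope to \<open>ln (z k) / 2 ^ Suc k\<close>, which decreases, while
  \<open>ln (z k - 1) / 2 ^ Suc k\<close> increases.\<close>

lemma z_log_telescope:
  "ln (1 - 1 / (z k)\<^sup>2) / 2 ^ (Suc k + 1) = ln (z (Suc k)) / 2 ^ Suc (Suc k) - ln (z k) / 2 ^ Suc k"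
proof -
  have z: "z k > 1"
    using z_ge[of k] by simp
  then have "z (Suc k) = (z k)\<^sup>2 * (1 - 1 / (z k)\<^sup>2)"
    by (simp add: field_simps)
  moreover have "(z k)\<^sup>2 > 1"
    using z by (simp add: one_less_power)
  ultimately have "ln (z (Suc k)) = ln ((z k)\<^sup>2) + ln (1 - 1 / (z k)\<^sup>2)"
    using z by (simp add: ln_mult del: xseq.simps)
  then have "ln (z (Suc k)) = 2 * ln (z k) + ln (1 - 1 / (z k)\<^sup>2)"
    using z by (simp add: ln_realpow del: xseq.simps)
  then show ?thesis
    by (simp add: field_simps)
qed

lemma beta_bounds:
  "ln (z k - 1) / 2 ^ Suc k \<le> beta_const" "beta_const \<le> ln (z k) / 2 ^ Suc k"
proof -
  let ?b = "\<lambda>k. ln (z k) / 2 ^ Suc k" and ?c = "\<lambda>k. ln (z k - 1) / 2 ^ Suc k"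
  have c_le_b: "?c k \<le> ?b k" for k
    using z_ge[of k] by (intro divide_right_mono) auto
  have "?b (Suc k) \<le> ?b k" for k
  proof -
    have "(z k)\<^sup>2 > 1"
      using z_ge[of k] by (simp add: one_less_power)
    then have "ln (1 - 1 / (z k)\<^sup>2) \<le> 0"
      by (subst ln_le_zero_iff) (auto simp: divide_less_eq)
    then show ?thesis
      using z_log_telescope[of k] by (smt (verit) divide_nonpos_pos zero_less_power)
  qed
  then have b_dec: "decseq ?b"
    by (rule decseq_SucI)
  have "?c k \<le> ?c (Suc k)" for k
  proof -
    have z: "z k \<ge> 13" by (rule z_ge)
    have "2 * ln (z k - 1) = ln ((z k - 1)\<^sup>2)"
      using z by (simp add: ln_realpow)
    also have "\<dots> \<le> ln (z (Suc k) - 1)"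
    proof (rule ln_mono)
      \<comment> \<open>\<open>z (Suc k) - 1\<close> is \<open>(z k)^2 - 2\<close>, so
        \<open>z k >= 3/2\<close> would suffice.\<close>
      show "(z k - 1)\<^sup>2 \<le> z (Suc k) - 1"
        using z by (simp add: power2_eq_square algebra_simps)
    qed (use z in simp)
    finally show ?thesis
      by (simp add: field_simps)
  qed
  then have c_inc: "incseq ?c"
    by (rule incseq_SucI)
  \<comment> \<open>Monotonicity moves both sides to the larger index. Hence \<open>?b\<close>
    converges, and its limit stays above every \<open>?c i\<close>.\<close>
  have lower: "?c i \<le> ?b j" for i j
  proof (cases "i \<le> j")
    case True
    then show ?thesis
      using incseqD[OF c_inc, of i j] c_le_b[of j] by linarith
  next
    case False
    then show ?thesis
      using decseqD[OF b_dec, of j i] c_le_b[of i] by linarith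
  qed
  have "\<forall>i. ?c 0 \<le> ?b i"
    by (intro allI lower)
  then obtain L where L: "?b \<longlonglongrightarrow> L"
    by (rule decseq_convergent[OF b_dec])
  have "(\<lambda>k. ?b (Suc k) - ?b k) sums (L - ?b 0)"
    by (rule telescope_sums[OF L])
  then have "(\<lambda>k. ln (1 - 1 / (z k)\<^sup>2) / 2 ^ (Suc k + 1)) sums (L - ?b 0)"
    by (simp only: z_log_telescope)
  then have "beta_const = L"
    unfolding beta_const_def by (simp add: sums_iff)
  moreover have "L \<le> ?b k"
    using decseq_ge[OF b_dec L] .
  moreover have "?c k \<le> L"
    using lower by (intro LIMSEQ_le_const[OF L]) auto
  ultimately show "?c k \<le> beta_const" "beta_const \<le> ?b k"
    by simp_all
qed

abbreviation \<alpha> :: real where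
  "\<alpha> \<equiv> alpha_const"

lemma alpha_pos: "\<alpha> > 0"
  by (simp add: alpha_const_def)

lemma alpha_pow_eq: "\<alpha> ^ (5 * 2 ^ k) = exp (2 ^ Suc k * beta_const)"
  by (simp add: alpha_const_def exp_of_nat_mult[symmetric])

lemma alpha_pow_le: "\<alpha> ^ (5 * 2 ^ k) \<le> z k"
proof -
  have "2 ^ Suc k * beta_const \<le> ln (z k)"
    using beta_bounds(2)[of k] by (simp add: field_simps)
  then have "exp (2 ^ Suc k * beta_const) \<le> exp (ln (z k))"
    by simp
  then show ?thesis
    using z_ge[of k] by (simp add: alpha_pow_eq)
qed

text \<open>The lower bound on \<open>beta_const\<close> is taken one index later, followed by a
  square root; index \<open>k\<close> itself would give only \<open>z k - 1\<close>.\<close>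

lemma alpha_pow_ge: "\<alpha> ^ (5 * 2 ^ k) \<ge> z k - 2 / z k"
proof -
  have z: "z k \<ge> 13" by (rule z_ge)
  have "ln (z (Suc k) - 1) \<le> 2 ^ Suc (Suc k) * beta_const"
    using beta_bounds(1)[of "Suc k"] by (simp add: field_simps)
  then have "exp (ln (z (Suc k) - 1)) \<le> exp (2 ^ Suc (Suc k) * beta_const)"
    by (simp only: exp_le_cancel_iff)
  then have "z (Suc k) - 1 \<le> \<alpha> ^ (5 * 2 ^ Suc k)"
    using z_ge[of "Suc k"] unfolding alpha_pow_eq by (simp del: xseq.simps)
  also have "\<dots> = (\<alpha> ^ (5 * 2 ^ k))\<^sup>2"
    by (simp add: power_mult[symmetric] mult_ac)
  finally have "(z k)\<^sup>2 - 2 \<le> (\<alpha> ^ (5 * 2 ^ k))\<^sup>2"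
    by simp
  moreover have "(z k - 2 / z k)\<^sup>2 \<le> (z k)\<^sup>2 - 2"
  proof -
    have "(z k - 2 / z k)\<^sup>2 = (z k)\<^sup>2 - 4 + 4 / (z k)\<^sup>2"
      using z by (simp add: power2_eq_square field_simps)
    moreover have "4 / (z k)\<^sup>2 \<le> 4 / 13\<^sup>2"
      using z by (intro divide_left_mono power_mono) auto
    ultimately show ?thesis by simp
  qed
  ultimately have "(z k - 2 / z k)\<^sup>2 \<le> (\<alpha> ^ (5 * 2 ^ k))\<^sup>2"
    by (rule order_trans[rotated])
  then show ?thesis
    by (rule power2_le_imp_le) (use alpha_pos in simp)
qed

lemma alpha_bounds: "1.66928 \<le> \<alpha>" "\<alpha> \<le> 1.671"
proof -
  \<comment> \<open>\<open>28223\<close> is \<open>z 2\<close>, and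
    \<open>20 = 5 * 2^2\<close>.\<close>
  have "(1.66928 :: real) ^ 20 \<le> 28223 - 2 / 28223"
    by (simp add: power_divide)
  also have "\<dots> \<le> \<alpha> ^ 20"
    using alpha_pow_ge[of 2] by (simp add: numeral_2_eq_2)
  finally show "1.66928 \<le> \<alpha>"
    using alpha_pos by (subst power_mono_iff[symmetric, of _ _ 20]) auto
  have "\<alpha> ^ 5 \<le> 13"
    using alpha_pow_le[of 0] by simp
  also have "(13 :: real) \<le> 1.671 ^ 5"
    by (simp add: power_divide)
  finally show "\<alpha> \<le> 1.671"
    using alpha_pos by (subst power_mono_iff[symmetric, of _ _ 5]) auto
qed

lemma alpha_power_ge: "\<alpha> ^ n \<ge> 1.66928 ^ n" and alpha_power_le: "\<alpha> ^ n \<le> 1.671 ^ n"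
  using alpha_bounds by (auto intro!: power_mono)

section \<open>The lower bound\<close>

fun F :: "nat \<Rightarrow> real \<Rightarrow> real" where
  "F 0 t = t"
| "F (Suc k) t = sqrt (F k (t\<^sup>2) + 1)"

lemma F_ge: "t \<ge> 0 \<Longrightarrow> t \<le> F k t"
proof (induction k arbitrary: t)
  case (Suc k)
  have "t\<^sup>2 \<le> F k (t\<^sup>2)"
    by (rule Suc.IH) simp
  then show ?case by (auto intro: real_le_rsqrt)
qed simp

text \<open>Scaling passes through the square roots except for the added 1, which is at most
  \<open>c^2\<close>. This turns extra vertices into factors \<alpha>.\<close>

lemma F_mult_le:
  assumes "c \<ge> 1" "t \<ge> 0"
  shows "F k (c * t) \<le> c * F k t"
  using assms
proof (induction k arbitrary: c t)
  case (Suc k)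
  have c: "c\<^sup>2 \<ge> 1"
    using Suc.prems by (simp add: one_le_power)
  have "F k ((c * t)\<^sup>2) + 1 \<le> c\<^sup>2 * F k (t\<^sup>2) + c\<^sup>2"
    using Suc.IH[OF c, of "t\<^sup>2"] c by (simp add: power_mult_distrib)
  then have "sqrt (F k ((c * t)\<^sup>2) + 1) \<le> sqrt (c\<^sup>2 * (F k (t\<^sup>2) + 1))"
    by (simp add: algebra_simps)
  also have "\<dots> = c * sqrt (F k (t\<^sup>2) + 1)"
    using Suc.prems by (simp add: real_sqrt_mult)
  finally show ?case by simp
qed simp

text \<open>By the arithmetic-geometric mean,
  \<open>sqrt (p * q) + 1 <= sqrt ((p + 1) * (q + 1))\<close>. The \<open>- 1\<close> of a join is
  paid by one level: level \<open>Suc k\<close> of the factors yields level \<open>k\<close> of the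
  product.\<close>

lemma F_mult_ge:
  assumes "s \<ge> 0" "t \<ge> 0"
  shows "F k (s * t) + 1 \<le> F (Suc k) s * F (Suc k) t"
  using assms
proof (induction k arbitrary: s t)
  case 0
  have "2 * (s * t) \<le> s\<^sup>2 + t\<^sup>2"
    using sum_squares_bound[of s t] by (simp add: mult_ac)
  then have "(s * t + 1)\<^sup>2 \<le> (s\<^sup>2 + 1) * (t\<^sup>2 + 1)"
    by (simp add: power2_eq_square algebra_simps)
  then show ?case
    by (simp add: real_le_rsqrt real_sqrt_mult[symmetric])
next
  case (Suc k)
  let ?p = "F (Suc k) (s\<^sup>2)" and ?q = "F (Suc k) (t\<^sup>2)"
  have pos: "?p \<ge> 0" "?q \<ge> 0"
    by (auto simp del: F.simps intro: order_trans[OF zero_le_power2 F_ge])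
  have "F k ((s * t)\<^sup>2) + 1 \<le> ?p * ?q"
    using Suc.IH[of "s\<^sup>2" "t\<^sup>2"] by (simp only: power_mult_distrib zero_le_power2)
  then have "F (Suc k) (s * t) + 1 \<le> sqrt (?p * ?q) + 1"
    by simp
  also have "\<dots> \<le> sqrt ((?p + 1) * (?q + 1))"
  proof (rule real_le_rsqrt)
    have "2 * sqrt (?p * ?q) \<le> ?p + ?q"
      using arith_geo_mean_sqrt[OF pos] by simp
    then show "(sqrt (?p * ?q) + 1)\<^sup>2 \<le> (?p + 1) * (?q + 1)"
      using pos by (simp only: power2_sum real_sqrt_pow2 mult_nonneg_nonneg) (simp add: algebra_simps)
  qed
  also have "\<dots> = F (Suc (Suc k)) s * F (Suc (Suc k)) t"
    by (simp only: F.simps real_sqrt_mult)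
  finally show ?case .
qed

text \<open>\<open>z i\<close> is the square root of \<open>z (Suc i) + 1\<close>, so each level is
  traded for one doubling, down to \<open>alpha_pow_le\<close> at level 0.\<close>

lemma F_alpha_pow_le: "F k (\<alpha> ^ (5 * 2 ^ i)) \<le> z i"
proof (induction k arbitrary: i)
  case 0
  then show ?case using alpha_pow_le by simp
next
  case (Suc k)
  have "(\<alpha> ^ (5 * 2 ^ i))\<^sup>2 = \<alpha> ^ (5 * 2 ^ Suc i)"
    by (simp add: power_mult[symmetric] mult_ac)
  then have "F (Suc k) (\<alpha> ^ (5 * 2 ^ i)) \<le> sqrt (z (Suc i) + 1)"
    using Suc.IH[of "Suc i"] by (simp del: xseq.simps)
  also have "\<dots> = z i"
    using z_ge[of i] by simp
  finally show ?case .
qed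

lemma F_alpha_add: "F k (\<alpha> ^ (m + n)) \<le> \<alpha> ^ m * F k (\<alpha> ^ n)"
  unfolding power_add using alpha_bounds by (intro F_mult_le one_le_power zero_le_power) auto

lemma F_alpha_5: "F k (\<alpha> ^ 5) \<le> 13"
  using F_alpha_pow_le[of k 0] by simp

text \<open>Here 3 and 5 are the values of \<open>I + 2\<close> for one vertex and for the chain of
  two. Unfolding doubles the exponent until 6 or 8, where \<open>F_alpha_5\<close> helps;
  \<open>8\<close>, \<open>24\<close> and \<open>63\<close> are \<open>b^2 - 1\<close> for
  \<open>b = 3, 5, 8\<close>.\<close>

lemma F_alpha_small: "F k (\<alpha> ^ 2) \<le> 3" "F k (\<alpha> ^ 3) \<le> 5"
proof -
  have le: "F k (\<alpha> ^ m) \<le> b" if "1.671 ^ m \<le> b" "\<And>k. F k (\<alpha> ^ (2 * m)) \<le> b\<^sup>2 - 1" "b \<ge> 0" for k m b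
  proof (cases k)
    case 0
    then show ?thesis using alpha_power_le[of m] that(1) by simp
  next
    case (Suc j)
    have "F j ((\<alpha> ^ m)\<^sup>2) + 1 \<le> b\<^sup>2"
      using that(2)[of j] by (simp add: power_mult[symmetric] mult.commute)
    then show ?thesis
      using Suc that(3) by (auto intro: real_le_lsqrt)
  qed
  have add5: "F k (\<alpha> ^ (m + 5)) \<le> 1.671 ^ m * 13" for k m
  proof -
    have "F k (\<alpha> ^ (m + 5)) \<le> \<alpha> ^ m * F k (\<alpha> ^ 5)"
      by (rule F_alpha_add)
    also have "\<dots> \<le> 1.671 ^ m * 13"
      using alpha_power_le F_alpha_5 alpha_pos by (intro mult_mono) (auto intro: order_trans[OF _ F_ge])
    finally show ?thesis .
  qed
  have 8: "F k (\<alpha> ^ 8) \<le> 63" for k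
    using add5[of k 3] by (simp add: power_divide)
  have 6: "F k (\<alpha> ^ 6) \<le> 24" for k
    using add5[of k 1] by (simp add: power_divide)
  have 4: "F k (\<alpha> ^ 4) \<le> 8" for k
    by (rule le) (use 8 in \<open>auto simp: power_divide\<close>)
  show "F k (\<alpha> ^ 2) \<le> 3"
    by (rule le) (use 4 in \<open>auto simp: power_divide\<close>)
  show "F k (\<alpha> ^ 3) \<le> 5"
    by (rule le) (use 6 in \<open>auto simp: power_divide\<close>)
qed

text \<open>Here \<open>a\<close> is meant to count the empty set too, so that \<open>a + 1\<close>
  is \<open>I + 2\<close>. The linear condition controls small trees; all levels are required
  because joining two children consumes one.\<close>

definition admissible :: "nat \<Rightarrow> real \<Rightarrow> bool" where
  "admissible n a \<longleftrightarrow> n \<ge> 1 \<and> a \<ge> 2 * real n \<and> (\<forall>k. F k (\<alpha> ^ (n + 1)) \<le> a + 1)"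

lemma admissible_ge_2: "admissible n a \<Longrightarrow> a \<ge> 2"
  by (auto simp: admissible_def)

lemma admissible_one_child:
  assumes "admissible n a"
  shows "F k (\<alpha> ^ (2 + n)) \<le> 2 * a + 1"
proof (cases "n = 1")
  case True
  then show ?thesis
    using F_alpha_small(2)[of k] admissible_ge_2[OF assms] by (simp add: numeral_3_eq_3)
next
  case False
  then have "a \<ge> 4" and *: "F k (\<alpha> ^ (n + 1)) \<le> a + 1"
    using assms by (auto simp: admissible_def)
  have "F k (\<alpha> ^ (1 + (n + 1))) \<le> \<alpha> ^ 1 * F k (\<alpha> ^ (n + 1))"
    by (rule F_alpha_add)
  also have "\<dots> \<le> 1.671 * (a + 1)"
    using * \<open>a \<ge> 4\<close> alpha_bounds by (intro mult_mono) (auto intro: order_trans[OF _ F_ge])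
  \<comment> \<open>Valid once \<open>a\<close> exceeds about 2.04, which just misses a leaf with
    \<open>a = 2\<close>; hence the separate case.\<close>
  also have "\<dots> \<le> 2 * a + 1"
    using \<open>a \<ge> 4\<close> by simp
  finally show ?thesis by simp
qed

text \<open>The right side is exactly \<open>(a + 1) * (b + 1) - 1\<close>, so
  \<open>F_mult_ge\<close> applies with nothing to add.\<close>

lemma admissible_two_children:
  assumes "admissible n a" "admissible m b"
  shows "F k (\<alpha> ^ (2 + n + m)) \<le> a * b + a + b"
proof -
  have "F k (\<alpha> ^ (n + 1) * \<alpha> ^ (m + 1)) + 1 \<le> F (Suc k) (\<alpha> ^ (n + 1)) * F (Suc k) (\<alpha> ^ (m + 1))"
    using alpha_pos by (intro F_mult_ge) auto
  also have "\<dots> \<le> (a + 1) * (b + 1)"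
    using assms alpha_pos admissible_ge_2[OF assms(1)] unfolding admissible_def
    by (intro mult_mono) (auto simp del: F.simps intro: order_trans[OF _ F_ge])
  finally show ?thesis
    by (simp add: power_add[symmetric] algebra_simps)
qed

text \<open>With \<open>P = \<Prod>a\<close> and \<open>S = \<Sum>(a - 1) + 2\<close> over the previous children, the new value exceeds
  \<open>\<alpha> ^ n * (P + S)\<close> as soon as \<open>P\<close> is large compared to \<open>S\<close>; this may fail when
  only two children precede and one of them is a leaf.\<close>

lemma admissible_append_child:
  assumes "admissible n a" and F: "F k (\<alpha> ^ N) \<le> P + S" and "S \<ge> 0"
    and "P \<ge> 16 \<and> 4 * S \<le> P + 16 \<or> P \<ge> 8 \<and> 3 * S \<le> P + 7"
  shows "F k (\<alpha> ^ (N + n)) \<le> a * P + S + a - 1"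
proof -
  let ?u = "\<alpha> ^ n"
  have "F k (\<alpha> ^ (n + N)) \<le> ?u * F k (\<alpha> ^ N)"
    by (rule F_alpha_add)
  also have "\<dots> \<le> ?u * (P + S)"
    using F alpha_pos by (intro mult_left_mono) auto
  also have "\<dots> \<le> a * P + S + a - 1"
  proof (cases "n = 1")
    case True
    have "a \<ge> 2" by (rule admissible_ge_2) fact
    then have "(a - \<alpha>) * P \<ge> 0.329 * P" "(\<alpha> - 1) * S \<le> 0.671 * S"
      using alpha_bounds assms(3,4) by (intro mult_right_mono; auto)+
    then show ?thesis
      using True \<open>a \<ge> 2\<close> assms(3,4) by (auto simp: algebra_simps)
  next
    case False
    then have n: "n \<ge> 2"
      using assms by (auto simp: admissible_def)
    have "\<alpha> ^ 2 \<le> ?u"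
      using n alpha_bounds by (intro power_increasing) auto
    moreover have "\<alpha> ^ 2 \<ge> 2.75"
      using alpha_power_ge[of 2] by (simp add: power_divide)
    ultimately have u: "?u \<ge> 2.75"
      by simp
    \<comment> \<open>Level 0 of \<open>F\<close> is the identity.\<close>
    have "\<alpha> ^ (n + 1) \<le> a + 1"
      using assms(1) F.simps(1) unfolding admissible_def by metis
    moreover have "1.66 * ?u \<le> \<alpha> ^ (n + 1)"
      using alpha_bounds by auto
    ultimately have a: "a \<ge> 1.66 * ?u - 1"
      by linarith
    then have aP: "(a - ?u) * P \<ge> (0.66 * ?u - 1) * P"
      using assms(4) by (intro mult_right_mono) auto
    \<comment> \<open>The goal amounts to \<open>(a - ?u) * P + a - 1 >= (?u - 1) * S\<close>;
      inserting \<open>a >= 1.66 * ?u - 1\<close> leaves this.\<close>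
    have "(0.66 * ?u - 1) * P + 1.66 * ?u - 2 \<ge> (?u - 1) * S"
      using assms(4)
    proof
      assume P: "P \<ge> 16 \<and> 4 * S \<le> P + 16"
      then have "(?u - 1) * (4 * S) \<le> (?u - 1) * (P + 16)"
        using u by (intro mult_left_mono) auto
      \<comment> \<open>After \<open>S <= P / 4 + 4\<close>, the coefficient of \<open>P\<close> is
        \<open>(0.66 - 1/4) * ?u - (1 - 1/4)\<close>. The second case is analogous, multiplied by
        3.\<close>
      moreover have "(0.41 * ?u - 0.75) * P \<ge> (0.41 * ?u - 0.75) * 16"
        using u P by (intro mult_left_mono) auto
      ultimately show ?thesis
        using u by (simp add: algebra_simps)
    next
      assume P: "P \<ge> 8 \<and> 3 * S \<le> P + 7"
      then have "(?u - 1) * (3 * S) \<le> (?u - 1) * (P + 7)"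
        using u by (intro mult_left_mono) auto
      moreover have "(0.98 * ?u - 2) * P \<ge> (0.98 * ?u - 2) * 8"
        using u P by (intro mult_left_mono) auto
      ultimately show ?thesis
        using u by (simp add: algebra_simps)
    qed
    then show ?thesis
      using aP a by (simp add: algebra_simps)
  qed
  finally show ?thesis
    by (simp add: add.commute)
qed

text \<open>Meant for two leaves beside a third child, where \<open>P = 4\<close> is too small for
  \<open>admissible_append_child\<close>; the exponent is \<open>2 + 1 + 1 + n\<close>. Since
  \<open>a * a' >= 4\<close>, the right side is at least \<open>5 * b + 3\<close>.\<close>

lemma admissible_two_small_children:
  assumes "admissible n b" "a \<ge> 2" "a' \<ge> 2"
  shows "F k (\<alpha> ^ (4 + n)) \<le> a * a' * b + a + a' + b - 1"
proof -
  have b: "b \<ge> 2" "b \<ge> 2 * real n" "n \<ge> 1"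
    using assms admissible_ge_2 by (auto simp: admissible_def)
  have "F k (\<alpha> ^ (4 + n)) \<le> 5 * b + 3"
  proof -
    consider "n = 1" | "n = 2" | "n \<ge> 3"
      using b by linarith
    then show ?thesis
    proof cases
      case 1
      \<comment> \<open>The star with three leaves: \<open>5 * 2 + 3 = 13\<close> leaves no slack in
        the bound.\<close>
      then show ?thesis using F_alpha_5[of k] b by (simp add: eval_nat_numeral)
    next
      case 2
      have "F k (\<alpha> ^ (1 + 5)) \<le> \<alpha> ^ 1 * F k (\<alpha> ^ 5)"
        by (rule F_alpha_add)
      also have "\<dots> \<le> 1.671 * 13"
        using F_alpha_5[of k] alpha_bounds by (intro mult_mono) (auto intro: order_trans[OF _ F_ge])
      finally show ?thesis using 2 b by simp
    next
      case 3
      have "F k (\<alpha> ^ (3 + (n + 1))) \<le> \<alpha> ^ 3 * F k (\<alpha> ^ (n + 1))"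
        by (rule F_alpha_add)
      also have "\<dots> \<le> 1.671 ^ 3 * (b + 1)"
        using assms(1) alpha_power_le[of 3] alpha_pos b unfolding admissible_def
        by (intro mult_mono) (auto intro: order_trans[OF _ F_ge])
      also have "\<dots> \<le> 5 * b + 3"
        using b 3 by (simp add: power_divide)
      finally show ?thesis by (simp add: add.commute)
    qed
  qed
  moreover have "a * a' \<ge> 2 * 2"
    using assms by (intro mult_mono) auto
  then have "a * a' * b \<ge> 4 * b"
    using b by (intro mult_right_mono) auto
  ultimately show ?thesis
    using assms by simp
qed

text \<open>Among three children, two have at least two vertices each or two are leaves. In the
  first situation those two are joined first, and \<open>(a - 4) * (b - 4) >= 0\<close> gives
  \<open>4 * (a + b) <= a * b + 16\<close>.\<close>

lemma admissible_three_children: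
  assumes "admissible n1 a1" "admissible n2 a2" "admissible n3 a3"
  shows "F k (\<alpha> ^ (2 + n1 + n2 + n3)) \<le> a1 * a2 * a3 + a1 + a2 + a3 - 1"
proof -
  have append: "F k (\<alpha> ^ (2 + n + m + l)) \<le> a * b * c + a + b + c - 1"
    if "admissible n a" "admissible m b" "admissible l c" "n \<ge> 2" "m \<ge> 2" for n m l a b c
  proof -
    have ab: "a \<ge> 4" "b \<ge> 4"
      using that by (auto simp: admissible_def)
    then have "(a - 4) * (b - 4) \<ge> 0" "a * b \<ge> 4 * 4"
      by (simp, intro mult_mono, auto)
    then show ?thesis
      using admissible_append_child[OF that(3)
        order_trans[OF admissible_two_children[OF that(1,2), of k]], of "a * b" "a + b"] ab
      by (simp add: algebra_simps)
  qed
  have pos: "n1 \<ge> 1" "n2 \<ge> 1" "n3 \<ge> 1" "a1 \<ge> 2" "a2 \<ge> 2" "a3 \<ge> 2"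
    using assms admissible_ge_2 by (auto simp: admissible_def)
  consider "n1 \<ge> 2" "n2 \<ge> 2" | "n1 \<ge> 2" "n3 \<ge> 2" | "n2 \<ge> 2" "n3 \<ge> 2"
    | "n1 = 1" "n2 = 1" | "n1 = 1" "n3 = 1" | "n2 = 1" "n3 = 1"
    using pos by linarith
  then show ?thesis
  proof cases
    case 1
    then show ?thesis using append[OF assms] by simp
  next
    case 2
    then show ?thesis using append[OF assms(1,3,2)] by (simp add: ac_simps)
  next
    case 3
    then show ?thesis using append[OF assms(2,3,1)] by (simp add: ac_simps)
  next
    case 4
    then have "2 + n1 + n2 + n3 = 4 + n3" by simp
    then show ?thesis
      using admissible_two_small_children[OF assms(3) pos(4,5), of k] by (simp only: ac_simps)
  next
    case 5
    then have "2 + n1 + n2 + n3 = 4 + n2" by simp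
    then show ?thesis
      using admissible_two_small_children[OF assms(2) pos(4,6), of k] by (simp only: ac_simps)
  next
    case 6
    then have "2 + n1 + n2 + n3 = 4 + n1" by simp
    then show ?thesis
      using admissible_two_small_children[OF assms(1) pos(5,6), of k] by (simp only: ac_simps)
  qed
qed

text \<open>Children are appended one at a time, with the second alternative of
  \<open>admissible_append_child\<close> as invariant. It starts at three children, where three
  leaves give equality (\<open>P = 8\<close>, \<open>S = 5\<close>).\<close>

lemma admissible_many_children:
  assumes "card C = m + 3" "\<And>c. c \<in> C \<Longrightarrow> admissible (n c) (a c)"
  shows "(\<forall>k. F k (\<alpha> ^ (2 + sum n C)) \<le> prod a C + ((\<Sum>c\<in>C. a c - 1) + 2))
    \<and> prod a C \<ge> 8 \<and> 3 * ((\<Sum>c\<in>C. a c - 1) + 2) \<le> prod a C + 7"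
  using assms
proof (induction m arbitrary: C)
  case 0
  then obtain x y w where C: "C = {x, y, w}" "x \<noteq> y" "y \<noteq> w" "x \<noteq> w"
    by (auto simp: card_3_iff)
  have g: "admissible (n x) (a x)" "admissible (n y) (a y)" "admissible (n w) (a w)"
    using 0 C by auto
  then have ge: "a x \<ge> 2" "a y \<ge> 2" "a w \<ge> 2"
    using admissible_ge_2 by auto
  have xy: "a x * a y \<ge> 2 * 2" "(a x - 2) * (a y - 2) \<ge> 0"
    using ge by (intro mult_mono, auto)
  then have xyw: "a x * a y * a w \<ge> 4 * 2" "(a x * a y - 4) * (a w - 2) \<ge> 0"
    using ge by (intro mult_mono, auto)
  then have "3 * (a x + a y + a w - 1) \<le> a x * a y * a w + 7"
    using xy ge by (simp add: algebra_simps)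
  then show ?case
    using C admissible_three_children[OF g] xyw(1) by (simp add: algebra_simps)
next
  case (Suc m)
  then obtain c C' where C: "C = insert c C'" "c \<notin> C'" "card C' = m + 3"
    by (metis add_Suc card_Suc_eq)
  then have fin: "finite C'"
    using card.infinite by fastforce
  define P where "P = prod a C'"
  define S where "S = (\<Sum>c\<in>C'. a c - 1) + 2"
  have IH: "\<And>k. F k (\<alpha> ^ (2 + sum n C')) \<le> P + S" "P \<ge> 8" "3 * S \<le> P + 7"
    using Suc.IH[OF C(3)] Suc.prems(2) C(1) unfolding P_def S_def by auto
  have S: "S \<ge> 0"
    unfolding S_def using Suc.prems(2) C(1) admissible_ge_2
    by (intro add_nonneg_nonneg sum_nonneg) fastforce+
  have gc: "admissible (n c) (a c)"
    using Suc.prems C by auto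
  then have ac: "a c \<ge> 2"
    by (rule admissible_ge_2)
  have "F k (\<alpha> ^ (2 + sum n C' + n c)) \<le> a c * P + S + a c - 1" for k
    using admissible_append_child[OF gc IH(1) S] IH by blast
  moreover have "(a c - 1) * P \<ge> (a c - 1) * 8"
    using IH ac by (intro mult_left_mono) auto
  then have "a c * P \<ge> P + 8 * (a c - 1)"
    by (simp add: algebra_simps)
  ultimately show ?case
    using C fin IH ac by (simp add: P_def[symmetric] S_def[symmetric] algebra_simps)
      (simp add: S_def algebra_simps)
qed

lemma admissible_children:
  assumes "finite C" "\<And>c. c \<in> C \<Longrightarrow> admissible (n c) (a c)"
  shows "F k (\<alpha> ^ (2 + sum n C)) \<le> prod a C + (\<Sum>c\<in>C. a c - 1) + 2"
proof -
  consider "card C = 0" | "card C = 1" | "card C = 2" | "card C \<ge> 3"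
    by linarith
  then show ?thesis
  proof cases
    case 1
    then show ?thesis using assms F_alpha_small(1)[of k] by simp
  next
    case 2
    then obtain x where "C = {x}" by (auto simp: card_1_singleton_iff)
    then show ?thesis using assms(2) admissible_one_child[of "n x" "a x" k] by (simp add: algebra_simps)
  next
    case 3
    then obtain x y where "C = {x, y}" "x \<noteq> y" by (auto simp: card_2_iff)
    then show ?thesis using assms(2) admissible_two_children[of "n x" "a x" "n y" "a y" k]
      by (simp add: algebra_simps)
  next
    case 4
    then have "card C = (card C - 3) + 3" by simp
    then show ?thesis using admissible_many_children[of C "card C - 3" n a] assms(2) by (simp add: add.assoc)
  qed
qed

text \<open>A Bernoulli-type inequality for the factors \<open>1 + (a c - 1)\<close>; it passes the
  linear condition of \<open>admissible\<close> from children to parent.\<close>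

lemma prod_ge_sum:
  fixes a :: "'b \<Rightarrow> real"
  assumes "finite C" "\<And>c. c \<in> C \<Longrightarrow> a c \<ge> 1"
  shows "prod a C \<ge> 1 + (\<Sum>c\<in>C. a c - 1)"
  using assms
proof (induction rule: finite_induct)
  case (insert x C)
  have "prod a C \<ge> 1"
    using insert by (intro prod_ge_1) auto
  then have "(a x - 1) * (prod a C - 1) \<ge> 0"
    using insert by (intro mult_nonneg_nonneg) auto
  then show ?case
    using insert by (simp add: algebra_simps)
qed simp

section \<open>Admissibility of every subtree\<close>

context rtree
begin

lemma admissible_desc:
  assumes "v \<in> V"
  shows "admissible (card (desc v)) (real (card (closed_sets v)))"
  using assms
proof (induction "card (desc v)" arbitrary: v rule: less_induct)
  case less
  let ?n = "\<lambda>v. card (desc v)" and ?a = "\<lambda>v. real (card (closed_sets v))"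
  let ?C = "children v"
  have n: "?n v = 1 + sum ?n ?C"
    by (rule card_desc) fact
  have a: "?a v = prod ?a ?C + (\<Sum>c\<in>?C. ?a c - 1) + 1"
    using card_closed_sets[OF less.prems] card_closed_sets_pos by (simp add: of_nat_diff)
  have C: "admissible (?n c) (?a c)" if "c \<in> ?C" for c
  proof -
    have "?n c \<le> sum ?n ?C"
      using that finite_children by (intro member_le_sum) auto
    then show ?thesis
      using less.hyps[of c] that children_subset n by auto
  qed
  have "F k (\<alpha> ^ (2 + sum ?n ?C)) \<le> ?a v + 1" for k
    using admissible_children[of ?C ?n ?a k] finite_children C a by simp
  moreover have "?a v \<ge> 2 * real (?n v)"
  proof -
    have "1 + (\<Sum>c\<in>?C. ?a c - 1) \<le> prod ?a ?C"
      using finite_children card_closed_sets_pos by (intro prod_ge_sum) auto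
    \<comment> \<open>\<open>a >= 2 * n\<close> and \<open>n >= 1\<close> give
      \<open>a - 1 >= n\<close>.\<close>
    moreover have "(\<Sum>c\<in>?C. real (?n c)) \<le> (\<Sum>c\<in>?C. ?a c - 1)"
      using C by (intro sum_mono) (fastforce simp: admissible_def)
    ultimately show ?thesis
      using a n by simp
  qed
  ultimately show ?case
    using n by (simp add: admissible_def)
qed

end

text \<open>Only level 0 of \<open>F\<close> is kept here; the higher levels served the
  induction.\<close>

lemma attains_ge:
  assumes "attains n i"
  shows "real i + 2 \<ge> \<alpha> ^ (n + 1)"
proof -
  obtain V par r where t: "rooted_tree V par r" "card V = n" "I_num V par r = i"
    using assms by (auto simp: attains_def)
  interpret rtree V par r
    using t by unfold_locales
  have "admissible n (real (card (closed_sets r)))"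
    using admissible_desc[OF root_in] t desc_root by simp
  then have "F 0 (\<alpha> ^ (n + 1)) \<le> real (card (closed_sets r)) + 1"
    unfolding admissible_def by blast
  then show ?thesis
    using I_num_eq card_closed_sets_pos[of r] t by (simp add: of_nat_diff)
qed

section \<open>The upper bound\<close>

text \<open>\<open>y\<close> is an upper bound, so that real estimates can be joined further;
  \<open>N\<close> is the order plus one, which is additive under joins.\<close>

definition reach :: "nat \<Rightarrow> real \<Rightarrow> bool" where
  "reach N y \<longleftrightarrow> N \<ge> 2 \<and> (\<exists>i. attains (N - 1) i \<and> real i + 2 \<le> y)"

lemma reach_mono: "reach N y \<Longrightarrow> y \<le> y' \<Longrightarrow> reach N y'"
  unfolding reach_def by fastforce

lemma reach_join:
  assumes "reach N y" "reach M w"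
  shows "reach (N + M) (y * w - 1)"
proof -
  obtain i j where ij: "attains (N - 1) i" "real i + 2 \<le> y" "attains (M - 1) j" "real j + 2 \<le> w"
    "N \<ge> 2" "M \<ge> 2"
    using assms by (auto simp: reach_def)
  have "(real i + 2) * (real j + 2) \<le> y * w"
    using ij by (intro mult_mono) auto
  moreover have "N - 1 + (M - 1) + 1 = N + M - 1"
    using ij by simp
  ultimately show ?thesis
    using attains_join2[OF ij(1,3)] ij unfolding reach_def
    by (auto simp: algebra_simps intro!: exI[of _ "(1 + i) * (1 + j) + i + j"])
qed

lemma reach_star: "reach (k + 2) (2 ^ k + k + 2)"
  using attains_star[of k] by (auto simp: reach_def)

lemma reach_pow: "reach (5 * 2 ^ k) (z k)"
proof (induction k)
  case 0
  then show ?case using reach_star[of 3] by simp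
next
  case (Suc k)
  then show ?case using reach_join[OF Suc Suc] by (simp add: power2_eq_square mult_2 algebra_simps)
qed

text \<open>By \<open>alpha_pow_ge\<close>, passing from \<open>z k\<close> to the power of \<alpha>
  costs at most \<open>1 - 2 / (z k)^2\<close>; as \<open>3 / (z (Suc k))^2 <= 1 / (z k)^2\<close>,
  the two losses multiply to at least \<open>1 - 3 / (z k)^2\<close>.\<close>

lemma z_step: "z k * (1 - 3 / (z k)\<^sup>2) \<le> \<alpha> ^ (5 * 2 ^ k) * (1 - 3 / (z (Suc k))\<^sup>2)"
proof -
  let ?z = "z k" and ?w = "z (Suc k)"
  have z: "?z \<ge> 13" by (rule z_ge)
  have w: "?w \<ge> 12 * ?z"
    using mult_right_mono[OF z, of ?z] z by (simp add: power2_eq_square; linarith)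
  have "3 / ?w\<^sup>2 \<le> 3 / (12 * ?z)\<^sup>2"
    using z w by (intro divide_left_mono power_mono) auto
  also have "\<dots> \<le> 1 / ?z\<^sup>2"
    using z by (simp add: divide_simps)
  finally have 1: "3 / ?w\<^sup>2 \<le> 1 / ?z\<^sup>2" .
  have "1 / ?z\<^sup>2 \<le> 1"
    using z by (simp add: one_le_power)
  then have "?z * (1 - 3 / ?z\<^sup>2) \<le> (?z - 2 / ?z) * (1 - 1 / ?z\<^sup>2)"
    using z by (simp add: field_simps power2_eq_square)
  also have "\<dots> \<le> \<alpha> ^ (5 * 2 ^ k) * (1 - 3 / ?w\<^sup>2)"
    using 1 \<open>1 / ?z\<^sup>2 \<le> 1\<close> alpha_pow_ge[of k] alpha_pos by (intro mult_mono) auto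
  finally show ?thesis .
qed

text \<open>Each block costs a factor \<open>z j / \<alpha> ^ (5 * 2 ^ j)\<close>, slightly above 1. The factor
  \<open>1 - 3 / (z (Suc j))\<^sup>2\<close> increases with \<open>j\<close> fast enough to pay for the next block, so that the
  total cost stays below 1.0032.\<close>

lemma reach_add_blocks_aux:
  assumes "reach s y" "q < 2 ^ Suc j"
  shows "reach (s + 5 * q) (1.0032 * (1 - 3 / (z (Suc j))\<^sup>2) * y * \<alpha> ^ (5 * q) - (if q = 0 then 0 else 1))"
  using assms(2)
proof (induction j arbitrary: q)
  case 0
  have y: "y \<ge> 0"
    using assms(1) by (auto simp: reach_def)
  consider "q = 0" | "q = 1"
    using 0 by fastforce
  then show ?case
  proof cases
    case 1
    then show ?thesis
      using y by (auto intro: reach_mono[OF assms(1)] simp: power_divide)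
  next
    case 2
    have "1.66928 ^ 5 \<le> \<alpha> ^ 5"
      by (rule alpha_power_ge)
    \<comment> \<open>\<open>168\<close> is \<open>z 1\<close>. The constant \<open>1.0032\<close>
      is slightly above \<open>13 / (1.66928^5 * (1 - 3 / 168^2))\<close>.\<close>
    then have "13 \<le> 1.0032 * (1 - 3 / 168\<^sup>2) * \<alpha> ^ 5"
      by (simp add: power_divide)
    then have "y * 13 \<le> y * (1.0032 * (1 - 3 / 168\<^sup>2) * \<alpha> ^ 5)"
      using y by (intro mult_left_mono)
    then show ?thesis
      using 2 reach_mono[OF reach_join[OF assms(1) reach_pow[of 0]]] by (simp add: mult_ac)
  qed
next
  case (Suc j)
  let ?z = "z (Suc j)" and ?w = "z (Suc (Suc j))" and ?N = "2 ^ Suc j :: nat"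
  have y: "y \<ge> 0"
    using assms(1) by (auto simp: reach_def)
  have z: "?z \<ge> 13" by (rule z_ge)
  have w: "?w \<ge> 12 * ?z"
    using mult_right_mono[OF z, of ?z] z by (simp add: power2_eq_square; linarith)
  show ?case
  proof (cases "q < ?N")
    case True
    have "3 / ?w\<^sup>2 \<le> 3 / ?z\<^sup>2"
      using z w by (intro divide_left_mono power_mono) auto
    then have "1.0032 * (1 - 3 / ?z\<^sup>2) * y * \<alpha> ^ (5 * q) \<le> 1.0032 * (1 - 3 / ?w\<^sup>2) * y * \<alpha> ^ (5 * q)"
      using y alpha_pos by (intro mult_right_mono mult_left_mono) auto
    then show ?thesis
      using reach_mono[OF Suc.IH[OF True]] by simp
  next
    case False
    \<comment> \<open>Removes the top binary digit of \<open>q\<close>, whose block comes from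
      \<open>reach_pow\<close>.\<close>
    define p where "p = q - ?N"
    have p: "q = p + ?N" "p < ?N"
      using False Suc.prems by (auto simp: p_def)
    let ?B = "1.0032 * (1 - 3 / ?z\<^sup>2) * y * \<alpha> ^ (5 * p)"
    \<comment> \<open>Forgets an earlier \<open>- 1\<close>; the join with the top block supplies a
      new one.\<close>
    have "reach (s + 5 * p) ?B"
      using Suc.IH[OF p(2)] by (rule reach_mono) simp
    then have "reach (s + 5 * q) (?B * ?z - 1)"
      using reach_join[OF _ reach_pow[of "Suc j"]] p(1) by (metis (no_types, lifting) add.assoc distrib_left)
    moreover have "?B * ?z \<le> 1.0032 * (1 - 3 / ?w\<^sup>2) * y * \<alpha> ^ (5 * q)"
    proof -
      have "?B * ?z = 1.0032 * y * \<alpha> ^ (5 * p) * (?z * (1 - 3 / ?z\<^sup>2))"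
        by (simp only: mult_ac)
      also have "\<dots> \<le> 1.0032 * y * \<alpha> ^ (5 * p) * (\<alpha> ^ (5 * ?N) * (1 - 3 / ?w\<^sup>2))"
        using y alpha_pos by (intro mult_left_mono z_step mult_nonneg_nonneg) auto
      also have "\<dots> = 1.0032 * (1 - 3 / ?w\<^sup>2) * y * \<alpha> ^ (5 * q)"
        unfolding p(1) distrib_left power_add by (simp only: mult_ac)
      finally show ?thesis .
    qed
    ultimately show ?thesis
      using p(1) by (auto intro: reach_mono)
  qed
qed

lemma reach_add_blocks:
  assumes "reach s y" "q \<ge> 1"
  shows "reach (s + 5 * q) (1.0032 * y * \<alpha> ^ (5 * q) - 1)"
proof -
  have y: "y \<ge> 0"
    using assms(1) by (auto simp: reach_def)
  have "q < 2 ^ Suc q"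
    using less_exp[of q] unfolding power_Suc by linarith
  from reach_add_blocks_aux[OF assms(1) this] show ?thesis
  proof (rule reach_mono)
    have "(1 - 3 / (z (Suc q))\<^sup>2) * (1.0032 * y * \<alpha> ^ (5 * q)) \<le> 1 * (1.0032 * y * \<alpha> ^ (5 * q))"
      using y alpha_pos by (intro mult_right_mono) auto
    then show "1.0032 * (1 - 3 / (z (Suc q))\<^sup>2) * y * \<alpha> ^ (5 * q) - (if q = 0 then 0 else 1)
        \<le> 1.0032 * y * \<alpha> ^ (5 * q) - 1"
      using assms(2) by (simp add: mult_ac)
  qed
qed

text \<open>The summand \<open>0.0775\<close> turns \<open>- 1\<close> into \<open>- 2\<close>:
  multiplied by \<open>\<alpha> ^ (5 * q) >= 12.95\<close> it exceeds 1.\<close>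

lemma reach_blocks_105:
  assumes "reach s y" "q \<ge> 1" "1.0032 * y + 0.0775 \<le> 1.05 * 1.66928 ^ s"
  shows "reach (s + 5 * q) (1.05 * \<alpha> ^ (s + 5 * q) - 2)"
proof (rule reach_mono[OF reach_add_blocks[OF assms(1,2)]])
  let ?A = "\<alpha> ^ (5 * q)"
  have "\<alpha> ^ (5 * 1) \<le> ?A"
    using assms(2) alpha_bounds by (intro power_increasing) auto
  moreover have "\<alpha> ^ 5 \<ge> 12.95"
    using alpha_power_ge[of 5] by (simp add: power_divide)
  ultimately have A: "?A \<ge> 12.95"
    by simp
  have "1.0032 * y + 0.0775 \<le> 1.05 * \<alpha> ^ s"
    using assms(3) alpha_power_ge[of s] by simp
  then have "(1.0032 * y + 0.0775) * ?A \<le> 1.05 * \<alpha> ^ s * ?A"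
    using A by (intro mult_right_mono) auto
  then show "1.0032 * y * ?A - 1 \<le> 1.05 * \<alpha> ^ (s + 5 * q) - 2"
    using A by (simp add: power_add algebra_simps)
qed

text \<open>Starting trees at 4, 5, 6, 8 and 12 cover the residues modulo 5. The star at 7 has value
  39, above \<open>1.05 * 1.66928^7\<close>, so residue 2 starts at 12, which is itself checked
  directly.\<close>

lemma reach_105:
  assumes "N \<ge> 9"
  shows "reach N (1.05 * \<alpha> ^ N - 2)"
proof -
  have 4: "reach 4 8" and 6: "reach 6 22"
    using reach_star[of 2] reach_star[of 4] by simp_all
  have 5: "reach 5 13"
    using reach_pow[of 0] by simp
  have 8: "reach 8 63" and 12: "reach 12 483"
    using reach_join[OF 4 4] reach_join[OF 6 6] by simp_all
  define d where "d = N div 5"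
  have "N = 5 * d \<or> N = 5 * d + 1 \<or> N = 5 * d + 2 \<or> N = 5 * d + 3 \<or> N = 5 * d + 4"
    unfolding d_def by presburger
  moreover have "N = 12 \<or> d \<ge> 3" if "N = 5 * d + 2"
    using that assms by presburger
  ultimately consider "N = 5 * d + 4" | "N = 5 * d" | "N = 5 * d + 1" | "N = 5 * d + 3"
    | "N = 12" | "N = 5 * d + 2" "d \<ge> 3"
    by blast
  then show ?thesis
  proof cases
    case 1
    then have "N = 4 + 5 * d" "d \<ge> 1"
      using assms by linarith+
    then show ?thesis
      using reach_blocks_105[OF 4, of "d"] by (simp add: power_divide del: power_Suc)
  next
    case 2
    then have "N = 5 + 5 * (d - 1)" "d - 1 \<ge> 1"
      using assms by linarith+
    then show ?thesis
      using reach_blocks_105[OF 5, of "d - 1"] by (simp add: power_divide del: power_Suc)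
  next
    case 3
    then have "N = 6 + 5 * (d - 1)" "d - 1 \<ge> 1"
      using assms by linarith+
    then show ?thesis
      using reach_blocks_105[OF 6, of "d - 1"] by (simp add: power_divide del: power_Suc)
  next
    case 4
    then have "N = 8 + 5 * (d - 1)" "d - 1 \<ge> 1"
      using assms by linarith+
    then show ?thesis
      using reach_blocks_105[OF 8, of "d - 1"] by (simp add: power_divide del: power_Suc)
  next
    case 5
    have "483 \<le> 1.05 * \<alpha> ^ 12 - 2"
      using alpha_power_ge[of 12] by (simp add: power_divide)
    then show ?thesis
      using 5 reach_mono[OF 12] by simp
  next
    case 6
    then have "N = 12 + 5 * (d - 2)" "d - 2 \<ge> 1"
      by linarith+
    then show ?thesis
      using reach_blocks_105[OF 12, of "d - 2"] by (simp add: power_divide)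
  qed
qed

lemma reach_m_min:
  assumes "reach (n + 1) y"
  shows "real (m_min n) + 2 \<le> y"
  using assms attains_m_min(2)[of n] unfolding reach_def by fastforce

theorem theorem5p1:
  shows "(\<forall>n\<ge>1. int (m_min n) \<ge> \<lceil>alpha_const ^ (n + 1)\<rceil> - 2)
       \<and> infinite {n. n \<ge> 1 \<and> int (m_min n) = \<lceil>alpha_const ^ (n + 1)\<rceil> - 2}
       \<and> (\<forall>n\<ge>8. int (m_min n) \<le> \<lfloor>1.05 * alpha_const ^ (n + 1)\<rfloor> - 4)"
proof (intro conjI)
  show lower: "\<forall>n\<ge>1. int (m_min n) \<ge> \<lceil>\<alpha> ^ (n + 1)\<rceil> - 2"
  proof (intro allI impI)
    fix n :: nat assume "n \<ge> 1"
    then have "\<alpha> ^ (n + 1) \<le> real_of_int (int (m_min n) + 2)"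
      using attains_ge[OF attains_m_min(1)] by (simp del: power_Suc)
    then have "\<lceil>\<alpha> ^ (n + 1)\<rceil> \<le> int (m_min n) + 2"
      by (simp only: ceiling_le_iff)
    then show "int (m_min n) \<ge> \<lceil>\<alpha> ^ (n + 1)\<rceil> - 2"
      by simp
  qed
  let ?E = "{n. n \<ge> 1 \<and> int (m_min n) = \<lceil>\<alpha> ^ (n + 1)\<rceil> - 2}"
  have E: "5 * 2 ^ k - 1 \<in> ?E" for k
  proof -
    let ?n = "5 * 2 ^ k - 1 :: nat"
    have "(2 :: nat) ^ k \<ge> 1" by simp
    then have n: "?n \<ge> 1" "?n + 1 = 5 * 2 ^ k" by linarith+
    have "real (m_min ?n) + 2 \<le> z k"
      using reach_m_min[of ?n "z k"] reach_pow[of k] unfolding n(2) by blast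
    moreover have "2 / z k < 1"
      using z_ge[of k] by simp
    \<comment> \<open>The distance \<open>2 / z k\<close> is below 1, and an integer strictly below
      \<open>\<alpha> ^ (?n + 1) + 1\<close> is at most the ceiling.\<close>
    ultimately have "real (m_min ?n) + 2 < \<alpha> ^ (?n + 1) + 1"
      using alpha_pow_ge[of k] unfolding n(2) by linarith
    then have "int (m_min ?n) + 2 \<le> \<lceil>\<alpha> ^ (?n + 1)\<rceil>"
      by linarith
    moreover have "int (m_min ?n) \<ge> \<lceil>\<alpha> ^ (?n + 1)\<rceil> - 2"
      using lower n(1) by blast
    ultimately show ?thesis
      using n(1) by (intro CollectI conjI antisym) linarith+
  qed
  show "infinite ?E"
  proof
    assume "finite ?E"
    then obtain m where m: "\<forall>n\<in>?E. n \<le> m"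
      unfolding finite_nat_set_iff_bounded_le by (rule exE)
    then have "5 * 2 ^ m - 1 \<le> m"
      by (rule bspec) (rule E)
    then show False
      using less_exp[of m] by linarith
  qed
  show "\<forall>n\<ge>8. int (m_min n) \<le> \<lfloor>1.05 * \<alpha> ^ (n + 1)\<rfloor> - 4"
  proof (intro allI impI)
    fix n :: nat assume "n \<ge> 8"
    then have "real (m_min n) + 4 \<le> 1.05 * \<alpha> ^ (n + 1)"
      using reach_m_min[OF reach_105[of "n + 1"]] by simp
    then have "int (m_min n) + 4 \<le> \<lfloor>1.05 * \<alpha> ^ (n + 1)\<rfloor>"
      by (subst le_floor_iff) simp
    then show "int (m_min n) \<le> \<lfloor>1.05 * \<alpha> ^ (n + 1)\<rfloor> - 4"
      by simp
  qed
qed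

end
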